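(* Let $d\ge1$, $0<c_j<1$ for $j\in D=\{1,\dots,d\}$, let $\mathbf{X}_0$ and $\mathbf{Y}_n=(Y_{n,1},\dots,Y_{n,d})$, $n\ge1$, be independent random vectors in $\mathbb{R}^d$ with $\mathbf{Y}_n\sim G$ for all $n$, and let $X_{n,j}=\max(c_jX_{n-1,j},\,Y_{n,j})$ for $n\ge1$, $j\in D$. Suppose $\{\mathbf{X}_n=(X_{n,1},\dots,X_{n,d})\}$ is stationary with common distribution function $F$ having continuous margins $F_1,\dots,F_d$. Let $j,j'\in D$ and $r\in\mathbb{N}_0$. If $F_{j'}\in\mathcal{D}(\Phi_{\alpha_{j'}})$ for some $\alpha_{j'}>0$, then $$\lambda_{jj'}^{(r)}(\mathbf{X})=2-\lim_{t\downarrow0}\frac1t\left(1-C_{jj'}\big(1-t,\,1-t\,c_{j'}^{r\alpha_{j'}}\big)\frac{1-t}{1-t\,c_{j'}^{r\alpha_{j'}}}\right),$$ where $C_{jj'}$ denotes the common copula of $(X_{n,j},X_{n,j'})$, $n\ge1$. Moreover, $0\le\lambda_{jj'}^{(r)}(\mathbf{X})\le c_{j'}^{\alpha_{j'}r}$.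
   Context: The lag-$r$ tail dependence coefficient is $\lambda_{jj'}^{(r)}(\mathbf{X})=\lim_{t\downarrow0}P\big(F_{j'}(X_{1+r,j'})>1-t\,\big|\,F_j(X_{1,j})>1-t\big)$ (when the limit exists). $\Phi_\alpha(x)=e^{-x^{-\alpha}}$ for $x>0$ and $0$ for $x\le0$. $F_{j'}\in\mathcal{D}(\Phi_{\alpha})$ means that there are constants $a_n>0$, $b_n$ with $F_{j'}^n(a_nx+b_n)\to\Phi_{\alpha}(x)$ as $n\to\infty$ for all $x$. $C_{jj'}(u,v)=P(F_j(X_{n,j})\le u,\,F_{j'}(X_{n,j'})\le v)$. *)

theory Defs
  imports "HOL-Probability.Probability"
begin

definition joint_cdf :: "'a measure \<Rightarrow> ('a \<Rightarrow> real ^ 'd) \<Rightarrow> real ^ 'd \<Rightarrow> real" where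
  "joint_cdf M Z x = \<P>(\<omega> in M. \<forall>i. Z \<omega> $ i \<le> x $ i)"

text \<open>Strict stationarity: the law of the whole path (on the product sigma-algebra), hence every
  finite-dimensional law, is shift invariant.\<close>

definition stationary_process :: "'a measure \<Rightarrow> 'b measure \<Rightarrow> (nat \<Rightarrow> 'a \<Rightarrow> 'b) \<Rightarrow> bool" where
  "stationary_process M S Z \<longleftrightarrow>
     (\<forall>k. distr M (Pi\<^sub>M UNIV (\<lambda>_. S)) (\<lambda>\<omega> n. Z (n + k) \<omega>)
        = distr M (Pi\<^sub>M UNIV (\<lambda>_. S)) (\<lambda>\<omega> n. Z n \<omega>))"

definition Frechet :: "real \<Rightarrow> real \<Rightarrow> real" where
  "Frechet \<alpha> x = (if x > 0 then exp (- (x powr (- \<alpha>))) else 0)"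

definition in_max_domain :: "(real \<Rightarrow> real) \<Rightarrow> (real \<Rightarrow> real) \<Rightarrow> bool" where
  "in_max_domain F H \<longleftrightarrow>
     (\<exists>a b :: nat \<Rightarrow> real. (\<forall>n. a n > 0) \<and>
        (\<forall>x. (\<lambda>n. F (a n * x + b n) ^ n) \<longlonglongrightarrow> H x))"

text \<open>In the next definitions \<open>Fm i\<close> is the distribution function of the \<open>i\<close>-th margin.\<close>

definition copula ::
  "'a measure \<Rightarrow> ('d \<Rightarrow> real \<Rightarrow> real) \<Rightarrow> ('a \<Rightarrow> real ^ 'd) \<Rightarrow> 'd \<Rightarrow> 'd \<Rightarrow> real \<Rightarrow> real \<Rightarrow> real" where
  "copula M Fm Z j j' u v = \<P>(\<omega> in M. Fm j (Z \<omega> $ j) \<le> u \<and> Fm j' (Z \<omega> $ j') \<le> v)"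

definition tail_prob ::
  "'a measure \<Rightarrow> ('d \<Rightarrow> real \<Rightarrow> real) \<Rightarrow> (nat \<Rightarrow> 'a \<Rightarrow> real ^ 'd) \<Rightarrow> nat \<Rightarrow> 'd \<Rightarrow> 'd \<Rightarrow> real \<Rightarrow> real" where
  "tail_prob M Fm X r j j' t =
     \<P>(\<omega> in M. Fm j' (X (1 + r) \<omega> $ j') > 1 - t \<bar> Fm j (X 1 \<omega> $ j) > 1 - t)"

definition tail_dep_exists ::
  "'a measure \<Rightarrow> ('d \<Rightarrow> real \<Rightarrow> real) \<Rightarrow> (nat \<Rightarrow> 'a \<Rightarrow> real ^ 'd) \<Rightarrow> nat \<Rightarrow> 'd \<Rightarrow> 'd \<Rightarrow> bool" where
  "tail_dep_exists M Fm X r j j' \<longleftrightarrow> (\<exists>l. (tail_prob M Fm X r j j' \<longlongrightarrow> l) (at_right 0))"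

text \<open>Only meaningful when \<^const>\<open>tail_dep_exists\<close> holds: \<^const>\<open>Lim\<close> is unspecified otherwise.\<close>

definition tail_dep ::
  "'a measure \<Rightarrow> ('d \<Rightarrow> real \<Rightarrow> real) \<Rightarrow> (nat \<Rightarrow> 'a \<Rightarrow> real ^ 'd) \<Rightarrow> nat \<Rightarrow> 'd \<Rightarrow> 'd \<Rightarrow> real" where
  "tail_dep M Fm X r j j' = Lim (at_right 0) (tail_prob M Fm X r j j')"

end

theory Submission
  imports Defs
begin



lemma antimono_family_tendsto:
  fixes f :: "'i \<Rightarrow> real \<Rightarrow> real" and g :: "real \<Rightarrow> real"
  assumes anti: "\<And>i. antimono (f i)"
    and lim: "\<And>x. x > 0 \<Longrightarrow> ((\<lambda>i. f i x) \<longlongrightarrow> g x) \<F>"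
    and cont: "continuous_on {0<..} g"
    and y: "(y \<longlongrightarrow> y0) \<F>" and "y0 > 0"
  shows "((\<lambda>i. f i (y i)) \<longlongrightarrow> g y0) \<F>"
proof (rule tendstoI)
  fix e :: real assume "e > 0"
  have "isCont g y0"
    using cont \<open>y0 > 0\<close> by (simp add: continuous_on_eq_continuous_at)
  then obtain d where d: "d > 0" "\<And>x. dist x y0 < d \<Longrightarrow> dist (g x) (g y0) < e / 2"
    using \<open>e > 0\<close> unfolding continuous_at_eps_delta by (metis half_gt_zero)
  define h where "h = min (d / 2) (y0 / 2)"
  have h: "h > 0" "h < d" "h < y0" using d \<open>y0 > 0\<close> by (auto simp: h_def)
  have g: "dist (g (y0 - h)) (g y0) < e / 2" "dist (g (y0 + h)) (g y0) < e / 2"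
    using h d(2)[of "y0 - h"] d(2)[of "y0 + h"] by (auto simp: dist_real_def)
  have "\<forall>\<^sub>F i in \<F>. dist (f i (y0 - h)) (g (y0 - h)) < e / 2"
       "\<forall>\<^sub>F i in \<F>. dist (f i (y0 + h)) (g (y0 + h)) < e / 2"
       "\<forall>\<^sub>F i in \<F>. dist (y i) y0 < h"
    using h \<open>y0 > 0\<close> \<open>e > 0\<close> by (intro tendstoD[OF lim] tendstoD[OF y]; simp)+
  then show "\<forall>\<^sub>F i in \<F>. dist (f i (y i)) (g y0) < e"
  proof eventually_elim
    case (elim i)
    have "f i (y0 + h) \<le> f i (y i)" "f i (y i) \<le> f i (y0 - h)"
      using elim(3) anti[of i] by (auto simp: antimono_def dist_real_def)
    then show ?case using elim(1,2) g unfolding dist_real_def by linarith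
  qed
qed

text \<open>The converse direction: a point that stayed away from \<open>y0\<close> along the filter would, by strict
  monotonicity of the limit, keep the values away from \<open>g y0\<close>. This makes normalizing constants
  recoverable from the limits that they produce.\<close>

lemma antimono_family_tendsto_inverse:
  fixes f :: "'i \<Rightarrow> real \<Rightarrow> real" and g :: "real \<Rightarrow> real"
  assumes anti: "\<And>i. antimono (f i)"
    and lim: "\<And>x. x > 0 \<Longrightarrow> ((\<lambda>i. f i x) \<longlongrightarrow> g x) \<F>"
    and strict: "\<And>x x'. 0 < x \<Longrightarrow> x < x' \<Longrightarrow> g x' < g x"
    and y: "((\<lambda>i. f i (y i)) \<longlongrightarrow> g y0) \<F>" and "y0 > 0"
  shows "(y \<longlongrightarrow> y0) \<F>"
proof (rule order_tendstoI)
  have less: "\<forall>\<^sub>F i in \<F>. x < y i" if x: "0 < x" "x < y0" for x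
  proof -
    have "g y0 < g x" using strict x by blast
    then obtain z where z: "g y0 < z" "z < g x" using dense by blast
    have "\<forall>\<^sub>F i in \<F>. f i (y i) < z" "\<forall>\<^sub>F i in \<F>. z < f i x"
      using y lim[of x] x z by (auto dest: order_tendstoD)
    then show ?thesis
    proof eventually_elim
      case (elim i)
      then show ?case using antimonoD[OF anti, of "y i" x i] by linarith
    qed
  qed
  show "\<forall>\<^sub>F i in \<F>. x < y i" if "x < y0" for x
  proof -
    have "\<forall>\<^sub>F i in \<F>. max x (y0 / 2) < y i"
      using that \<open>y0 > 0\<close> by (intro less) auto
    then show ?thesis by eventually_elim simp
  qed
  show "\<forall>\<^sub>F i in \<F>. y i < x" if x: "y0 < x" for x
  proof -
    have "g x < g y0" using strict x \<open>y0 > 0\<close> by blast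
    then obtain z where z: "g x < z" "z < g y0" using dense by blast
    have "\<forall>\<^sub>F i in \<F>. z < f i (y i)" "\<forall>\<^sub>F i in \<F>. f i x < z"
      using y lim[of x] x z \<open>y0 > 0\<close> by (auto dest: order_tendstoD)
    then show ?thesis
    proof eventually_elim
      case (elim i)
      then show ?case using antimonoD[OF anti, of x "y i" i] by linarith
    qed
  qed
qed

section \<open>Regular variation in the Frechet domain of attraction\<close>

text \<open>With \<open>z\<^sub>n = - ln (p n)\<close> the hypothesis says \<open>n z\<^sub>n \<longlongrightarrow> s\<close>; hence \<open>z\<^sub>n \<longlongrightarrow> 0\<close>, and
  \<open>1 - p n = 1 - exp (- z\<^sub>n)\<close> is asymptotically \<open>z\<^sub>n\<close>.\<close>

lemma power_tendsto_imp_scaled_complement_tendsto: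
  fixes p :: "nat \<Rightarrow> real"
  assumes p: "\<And>n. 0 \<le> p n" and lim: "(\<lambda>n. p n ^ n) \<longlonglongrightarrow> exp (- s)" and "s > 0"
  shows "(\<lambda>n. real n * (1 - p n)) \<longlonglongrightarrow> s"
proof -
  define z where "z n = - ln (p n)" for n
  have pos: "\<forall>\<^sub>F n in sequentially. p n > 0 \<and> n > 0"
    using order_tendstoD(1)[OF lim exp_gt_zero] eventually_gt_at_top[of 0]
  proof eventually_elim
    case (elim n)
    then show ?case using p[of n] by (cases "p n = 0") (auto simp: zero_power)
  qed
  have "(\<lambda>n. - ln (p n ^ n)) \<longlonglongrightarrow> - ln (exp (- s))"
    by (intro tendsto_intros lim) auto
  moreover have "\<forall>\<^sub>F n in sequentially. - ln (p n ^ n) = real n * z n"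
    using pos by eventually_elim (simp add: z_def ln_realpow)
  ultimately have nz: "(\<lambda>n. real n * z n) \<longlonglongrightarrow> s"
    by (simp add: tendsto_cong)
  have "(\<lambda>n. (real n * z n) * (1 / real n)) \<longlonglongrightarrow> s * 0"
    by (intro tendsto_mult nz lim_1_over_n)
  moreover have "\<forall>\<^sub>F n in sequentially. (real n * z n) * (1 / real n) = z n"
    using pos by eventually_elim simp
  ultimately have z0: "z \<longlonglongrightarrow> 0" by (simp add: tendsto_cong)
  have zpos: "\<forall>\<^sub>F n in sequentially. z n > 0"
    using order_tendstoD(1)[OF nz \<open>s > 0\<close>] by eventually_elim (simp add: zero_less_mult_iff)
  have "((\<lambda>h::real. (exp (0 + h) - exp 0) / h) \<longlongrightarrow> exp 0) (at 0)"
    using DERIV_exp[of 0] unfolding DERIV_def .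
  moreover have "filterlim (\<lambda>n. - z n) (at 0) sequentially"
    using tendsto_minus[OF z0] zpos by (auto simp: filterlim_at elim: eventually_mono)
  ultimately have "(\<lambda>n. (exp (- z n) - 1) / - z n) \<longlonglongrightarrow> 1"
    using filterlim_compose by fastforce
  then have "(\<lambda>n. (real n * z n) * ((exp (- z n) - 1) / - z n)) \<longlonglongrightarrow> s * 1"
    by (intro tendsto_mult nz)
  moreover have "\<forall>\<^sub>F n in sequentially.
      (real n * z n) * ((exp (- z n) - 1) / - z n) = real n * (1 - p n)"
    using pos zpos by eventually_elim (simp add: z_def field_simps)
  ultimately show ?thesis by (simp add: tendsto_cong)
qed

text \<open>Eventually each halving step multiplies the deviation by at most some \<open>\<theta> < 1\<close>, up to an error whose
  accumulated effect is at most \<open>e / 2\<close>; large indices admit arbitrarily many such steps.\<close>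

lemma contracting_halving_recursion_tendsto_0:
  fixes \<beta> \<rho> \<epsilon> :: "nat \<Rightarrow> real"
  assumes rec: "\<forall>\<^sub>F n in sequentially. \<beta> n = \<rho> n * \<beta> (n div 2) + \<epsilon> n"
    and \<rho>: "\<rho> \<longlonglongrightarrow> \<rho>0" "0 \<le> \<rho>0" "\<rho>0 < 1" and \<epsilon>: "\<epsilon> \<longlonglongrightarrow> 0"
  shows "\<beta> \<longlonglongrightarrow> 0"
proof (rule tendstoI)
  fix e :: real assume "e > 0"
  define \<theta> where "\<theta> = (\<rho>0 + 1) / 2"
  have \<theta>: "0 < \<theta>" "\<theta> < 1" "\<rho>0 < \<theta>" using \<rho> by (auto simp: \<theta>_def)
  have "\<forall>\<^sub>F n in sequentially. dist (\<epsilon> n) 0 < (1 - \<theta>) * (e / 2)"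
    using \<epsilon> \<theta> \<open>e > 0\<close> by (intro tendstoD) auto
  moreover have "\<forall>\<^sub>F n in sequentially. \<rho> n < \<theta>" "\<forall>\<^sub>F n in sequentially. - \<theta> < \<rho> n"
    using \<rho> \<theta> by (auto intro: order_tendstoD)
  ultimately have "\<forall>\<^sub>F n in sequentially.
      \<bar>\<beta> n\<bar> \<le> \<theta> * \<bar>\<beta> (n div 2)\<bar> + (1 - \<theta>) * (e / 2)"
    using rec
  proof eventually_elim
    case (elim n)
    have "\<bar>\<rho> n * \<beta> (n div 2)\<bar> \<le> \<theta> * \<bar>\<beta> (n div 2)\<bar>"
      unfolding abs_mult using elim by (intro mult_right_mono) auto
    moreover have "\<bar>\<epsilon> n\<bar> \<le> (1 - \<theta>) * (e / 2)" using elim(1) by simp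
    ultimately show ?case unfolding elim(4) by linarith
  qed
  then obtain N where N: "\<And>n. n \<ge> N \<Longrightarrow> \<bar>\<beta> n\<bar> \<le> \<theta> * \<bar>\<beta> (n div 2)\<bar> + (1 - \<theta>) * (e / 2)"
    unfolding eventually_sequentially by blast
  define B where "B = (\<Sum>n\<le>N. \<bar>\<beta> n\<bar>)"
  have "B \<ge> 0" unfolding B_def by (intro sum_nonneg) auto
  \<comment> \<open>A uniform bound is needed before the contraction can be iterated; \<open>B\<close> covers the
    finitely many indices at which the estimate may fail.\<close>
  have bound: "\<bar>\<beta> n\<bar> \<le> B + e / 2" for n
  proof (induction n rule: less_induct)
    case (less n)
    show ?case
    proof (cases "n \<le> N")
      case True
      then have "\<bar>\<beta> n\<bar> \<le> B" unfolding B_def by (intro member_le_sum) auto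
      then show ?thesis using \<open>e > 0\<close> by simp
    next
      case False
      then have "\<theta> * \<bar>\<beta> (n div 2)\<bar> \<le> \<theta> * (B + e / 2)"
        using \<theta> less.IH[of "n div 2"] by (intro mult_left_mono) auto
      moreover have "\<theta> * (B + e / 2) + (1 - \<theta>) * (e / 2) = \<theta> * B + e / 2"
        by (simp add: field_simps)
      ultimately have "\<bar>\<beta> n\<bar> \<le> \<theta> * B + e / 2" using N[of n] False by linarith
      also have "\<theta> * B \<le> B" using \<theta> \<open>B \<ge> 0\<close> by (simp add: mult_left_le_one_le)
      finally show ?thesis by simp
    qed
  qed
  have decay: "n \<ge> 2 ^ k * N \<Longrightarrow> \<bar>\<beta> n\<bar> \<le> \<theta> ^ k * B + e / 2" for k n
  proof (induction k arbitrary: n)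
    case 0
    then show ?case using bound by simp
  next
    case (Suc k)
    have "N \<le> 2 ^ Suc k * N" by simp
    then have "N \<le> n" using Suc.prems by linarith
    moreover have "2 ^ k * N \<le> n div 2" using Suc.prems by simp
    then have "\<theta> * \<bar>\<beta> (n div 2)\<bar> \<le> \<theta> * (\<theta> ^ k * B + e / 2)"
      using \<theta> Suc.IH by (intro mult_left_mono) auto
    moreover have "\<theta> * (\<theta> ^ k * B + e / 2) + (1 - \<theta>) * (e / 2) = \<theta> ^ Suc k * B + e / 2"
      by (simp add: field_simps)
    ultimately show ?case using N[of n] by linarith
  qed
  have "(\<lambda>k. \<theta> ^ k * B) \<longlonglongrightarrow> 0 * B" using \<theta> by (intro tendsto_intros LIMSEQ_power_zero) auto
  then have "\<forall>\<^sub>F k in sequentially. \<theta> ^ k * B < e / 2" 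
    using \<open>e > 0\<close> by (intro order_tendstoD) auto
  then obtain k where "\<theta> ^ k * B < e / 2" unfolding eventually_sequentially by blast
  then have small: "\<bar>\<beta> n\<bar> < e" if "n \<ge> 2 ^ k * N" for n
    using decay[OF that] by simp
  show "\<forall>\<^sub>F n in sequentially. dist (\<beta> n) 0 < e"
    using eventually_ge_at_top[of "2 ^ k * N"]
    by eventually_elim (simp add: small)
qed

lemma filterlim_div_two: "filterlim (\<lambda>n::nat. n div 2) at_top at_top"
  unfolding filterlim_at_top eventually_sequentially
  by (metis div_le_mono nonzero_mult_div_cancel_left zero_neq_numeral)

lemma tendsto_div_two_ratio: "(\<lambda>n. real (n div 2) / real n) \<longlonglongrightarrow> 1 / 2"
proof (rule tendsto_sandwich)
  show "(\<lambda>n. 1 / 2 - 1 / real n) \<longlonglongrightarrow> 1 / 2"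
    using tendsto_diff[OF tendsto_const lim_1_over_n, of "1/2::real"] by simp
  show "\<forall>\<^sub>F n in sequentially. 1 / 2 - 1 / real n \<le> real (n div 2) / real n"
    using eventually_gt_at_top[of 0]
  proof eventually_elim
    case (elim n)
    have "real n \<le> 2 * real (n div 2) + 1" by linarith
    then have "(real n - 2) / (2 * real n) \<le> (2 * real (n div 2)) / (2 * real n)"
      by (intro divide_right_mono) auto
    then show ?case using elim by (simp add: diff_divide_distrib)
  qed
  show "\<forall>\<^sub>F n in sequentially. real (n div 2) / real n \<le> 1 / 2"
    using eventually_gt_at_top[of 0]
  proof eventually_elim
    case (elim n)
    have "2 * real (n div 2) \<le> real n" by linarith
    then show ?case using elim by (simp add: field_simps)
  qed
qed auto

text \<open>The centring constants are asymptotically negligible because the limit law has positive tail index,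
  so that the scales \<open>a n\<close> grow geometrically along halving chains. The functions \<open>T n\<close> are the
  rescaled tails; \<open>T n\<close> and \<open>T (n div 2)\<close> describe the same tail in two affine coordinates, and \<open>y x n\<close>
  is the change of coordinates. Both have the same limit \<open>g\<close>, up to the factor \<open>2\<close> between the indices,
  which forces the change of coordinates to converge to the dilation by \<open>\<kappa>\<close>.\<close>

lemma Frechet_domain_centred:
  fixes F :: "real \<Rightarrow> real"
  assumes mono: "mono F" and F: "\<And>x. 0 \<le> F x" and "\<alpha> > 0"
    and dom: "in_max_domain F (Frechet \<alpha>)"
  obtains a :: "nat \<Rightarrow> real" where "\<And>n. a n > 0"
    "\<And>x. x > 0 \<Longrightarrow> (\<lambda>n. real n * (1 - F (a n * x))) \<longlonglongrightarrow> x powr (- \<alpha>)"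
proof -
  obtain a b where a: "\<And>n. a n > 0"
    and ab: "\<And>x. (\<lambda>n. F (a n * x + b n) ^ n) \<longlonglongrightarrow> Frechet \<alpha> x"
    using dom unfolding in_max_domain_def by blast
  define T where "T n x = real n * (1 - F (a n * x + b n))" for n x
  define g where "g x = x powr (- \<alpha>)" for x :: real
  have T: "(\<lambda>n. T n x) \<longlonglongrightarrow> g x" if "x > 0" for x
    unfolding T_def g_def
    using ab[of x] that F by (intro power_tendsto_imp_scaled_complement_tendsto) (auto simp: Frechet_def)
  have anti: "antimono (T n)" for n
    unfolding T_def antimono_def using a[of n]
    by (auto intro!: mult_left_mono monoD[OF mono])
  have strict: "g x' < g x" if "0 < x" "x < x'" for x x'
    unfolding g_def using that \<open>\<alpha> > 0\<close> by (intro powr_less_mono2_neg) auto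
  have cont: "continuous_on {0<..} g"
    unfolding g_def by (intro continuous_intros) auto
  define \<kappa> where "\<kappa> = (2::real) powr (1 / \<alpha>)"
  have \<kappa>: "\<kappa> > 1" using \<open>\<alpha> > 0\<close> unfolding \<kappa>_def by simp
  define y where "y x n = (a n * x + b n - b (n div 2)) / a (n div 2)" for x n
  have y: "y x \<longlonglongrightarrow> \<kappa> * x" if "x > 0" for x
  proof (rule antimono_family_tendsto_inverse[where f = "\<lambda>n. T (n div 2)" and g = g])
    show "(\<lambda>n. T (n div 2) x) \<longlonglongrightarrow> g x" if "x > 0" for x
      using filterlim_compose[OF T[OF that] filterlim_div_two] .
    have "(\<lambda>n. (real (n div 2) / real n) * T n x) \<longlonglongrightarrow> 1 / 2 * g x"
      by (intro tendsto_mult tendsto_div_two_ratio T that)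
    moreover have "\<forall>\<^sub>F n in sequentially. (real (n div 2) / real n) * T n x = T (n div 2) (y x n)"
      using eventually_gt_at_top[of 0]
      by eventually_elim (use a in \<open>simp add: T_def y_def less_imp_neq[THEN not_sym]\<close>)
    moreover have "1 / 2 * g x = g (\<kappa> * x)"
      using that \<open>\<alpha> > 0\<close> unfolding g_def \<kappa>_def
      by (simp add: powr_mult powr_powr powr_minus field_simps)
    ultimately show "(\<lambda>n. T (n div 2) (y x n)) \<longlonglongrightarrow> g (\<kappa> * x)"
      by (simp add: tendsto_cong)
  qed (use anti strict that \<kappa> in auto)
  \<comment> \<open>\<open>y\<close> is affine in \<open>x\<close>, so its values at 1 and 2 determine slope and intercept.\<close>
  have "(\<lambda>n. y 2 n - y 1 n) \<longlonglongrightarrow> \<kappa> * 2 - \<kappa> * 1"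
    by (intro tendsto_diff y) auto
  then have "(\<lambda>n. a n / a (n div 2)) \<longlonglongrightarrow> \<kappa>"
    by (simp add: y_def diff_divide_distrib[symmetric] algebra_simps)
  then have "(\<lambda>n. inverse (a n / a (n div 2))) \<longlonglongrightarrow> inverse \<kappa>"
    using \<kappa> by (intro tendsto_inverse) auto
  then have \<rho>: "(\<lambda>n. a (n div 2) / a n) \<longlonglongrightarrow> 1 / \<kappa>"
    by (simp add: inverse_eq_divide)
  have "(\<lambda>n. 2 * y 1 n - y 2 n) \<longlonglongrightarrow> 2 * (\<kappa> * 1) - \<kappa> * 2"
    by (intro tendsto_diff tendsto_mult y) auto
  then have \<delta>: "(\<lambda>n. (b n - b (n div 2)) / a (n div 2)) \<longlonglongrightarrow> 0"
    by (simp add: y_def diff_divide_distrib[symmetric] algebra_simps)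
  define \<beta> where "\<beta> n = b n / a n" for n
  have "\<beta> \<longlonglongrightarrow> 0"
  proof (rule contracting_halving_recursion_tendsto_0[OF _ \<rho>])
    show "\<forall>\<^sub>F n in sequentially. \<beta> n = a (n div 2) / a n * \<beta> (n div 2)
        + (a (n div 2) / a n) * ((b n - b (n div 2)) / a (n div 2))"
    proof (intro always_eventually allI)
      fix n
      show "\<beta> n = a (n div 2) / a n * \<beta> (n div 2)
        + (a (n div 2) / a n) * ((b n - b (n div 2)) / a (n div 2))"
        using a[of n] a[of "n div 2"] by (simp add: \<beta>_def field_simps)
    qed
    show "(\<lambda>n. (a (n div 2) / a n) * ((b n - b (n div 2)) / a (n div 2))) \<longlonglongrightarrow> 0"
      using tendsto_mult[OF \<rho> \<delta>] by simp
  qed (use \<kappa> in auto)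
  have "(\<lambda>n. real n * (1 - F (a n * x))) \<longlonglongrightarrow> x powr (- \<alpha>)" if "x > 0" for x
  proof -
    have "(\<lambda>n. T n (x - \<beta> n)) \<longlonglongrightarrow> g x"
      using anti T cont _ \<open>x > 0\<close>
    proof (rule antimono_family_tendsto)
      show "(\<lambda>n. x - \<beta> n) \<longlonglongrightarrow> x"
        using tendsto_diff[OF tendsto_const \<open>\<beta> \<longlonglongrightarrow> 0\<close>, of x] by simp
    qed
    moreover have "T n (x - \<beta> n) = real n * (1 - F (a n * x))" for n
      using a[of n] by (simp add: T_def \<beta>_def right_diff_distrib)
    ultimately show ?thesis by (simp add: g_def)
  qed
  then show ?thesis by (rule that[OF a])
qed

text \<open>Regular variation of the tail along the quantiles \<open>x t\<close>. At the integer \<open>n = floor (1 / t)\<close> the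
  rescaled tail at \<open>x t / a n\<close> equals \<open>n t\<close>, which tends to 1, so \<open>x t / a n \<longlongrightarrow> 1\<close>; evaluating the same tail at
  \<open>x t / l\<close> then gives the ratio. The full sequence of indices is what spares an interpolation
  between consecutive scales.\<close>

lemma Frechet_domain_tail_ratio:
  fixes F x :: "real \<Rightarrow> real"
  assumes mono: "mono F" and F: "\<And>x. 0 \<le> F x" and "\<alpha> > 0"
    and dom: "in_max_domain F (Frechet \<alpha>)"
    and x: "\<And>t. 0 < t \<Longrightarrow> t < 1 \<Longrightarrow> F (x t) = 1 - t" and "l > 0"
  shows "((\<lambda>t. (1 - F (x t / l)) / t) \<longlongrightarrow> l powr \<alpha>) (at_right 0)"
proof -
  obtain a where a: "\<And>n. a n > 0"
    and lim: "\<And>x. x > 0 \<Longrightarrow> (\<lambda>n. real n * (1 - F (a n * x))) \<longlonglongrightarrow> x powr (- \<alpha>)"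
    using Frechet_domain_centred[OF mono F \<open>\<alpha> > 0\<close> dom] by blast
  define n where "n t = nat \<lfloor>1 / t\<rfloor>" for t :: real
  have n: "filterlim n at_top (at_right 0)"
    unfolding n_def
    by (rule filterlim_compose[OF filterlim_nat_sequentially
          filterlim_compose[OF filterlim_floor_sequentially]])
       (simp add: divide_inverse filterlim_inverse_at_top_right)
  define S where "S t z = real (n t) * (1 - F (a (n t) * z))" for t z
  have S: "((\<lambda>t. S t z) \<longlongrightarrow> z powr (- \<alpha>)) (at_right 0)" if "z > 0" for z
    unfolding S_def using filterlim_compose[OF lim[OF that] n] .
  have anti: "antimono (S t)" for t
    unfolding S_def antimono_def using a[of "n t"]
    by (auto intro!: mult_left_mono monoD[OF mono])
  have small: "\<forall>\<^sub>F t::real in at_right 0. 0 < t \<and> t < 1"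
    by (auto simp: eventually_at_right_field intro!: exI[of _ 1])
  have nt: "((\<lambda>t. real (n t) * t) \<longlongrightarrow> 1) (at_right 0)"
  proof (rule tendsto_sandwich)
    show "((\<lambda>t::real. 1 - t) \<longlongrightarrow> 1) (at_right 0)"
      by (auto intro!: tendsto_eq_intros)
    show "\<forall>\<^sub>F t in at_right 0. 1 - t \<le> real (n t) * t"
      using small
    proof eventually_elim
      case (elim t)
      have "1 / t - 1 \<le> real (n t)" using elim unfolding n_def by linarith
      then have "(1 / t - 1) * t \<le> real (n t) * t" using elim by (intro mult_right_mono) auto
      moreover have "(1 / t - 1) * t = 1 - t" using elim by (simp add: field_simps)
      ultimately show ?case by simp
    qed
    show "\<forall>\<^sub>F t in at_right 0. real (n t) * t \<le> 1"
      using small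
    proof eventually_elim
      case (elim t)
      have "real (n t) \<le> 1 / t" using elim unfolding n_def by simp
      then show ?case using elim by (simp add: field_simps)
    qed
  qed auto
  have y: "((\<lambda>t. x t / a (n t)) \<longlongrightarrow> 1) (at_right 0)"
  proof (rule antimono_family_tendsto_inverse[where f = S, OF anti S])
    have "\<forall>\<^sub>F t in at_right 0. real (n t) * t = S t (x t / a (n t))"
      using small
    proof eventually_elim
      case (elim t)
      have "a (n t) * (x t / a (n t)) = x t" using a[of "n t"] by simp
      then show ?case using elim x[of t] by (simp add: S_def)
    qed
    with nt show "((\<lambda>t. S t (x t / a (n t))) \<longlongrightarrow> 1 powr - \<alpha>) (at_right 0)"
      by (simp add: tendsto_cong)
  qed (use \<open>\<alpha> > 0\<close> in \<open>auto intro: powr_less_mono2_neg\<close>)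
  have "((\<lambda>t. S t (x t / a (n t) / l)) \<longlongrightarrow> (1 / l) powr (- \<alpha>)) (at_right 0)"
  proof (rule antimono_family_tendsto[OF anti S])
    show "((\<lambda>t. x t / a (n t) / l) \<longlongrightarrow> 1 / l) (at_right 0)"
      using \<open>l > 0\<close> by (intro tendsto_divide y) auto
    show "continuous_on {0<..} (\<lambda>z. z powr - \<alpha>)" by (intro continuous_intros) auto
  qed (use \<open>l > 0\<close> in auto)
  then have "((\<lambda>t. S t (x t / a (n t) / l) / (real (n t) * t))
      \<longlongrightarrow> (1 / l) powr (- \<alpha>) / 1) (at_right 0)"
    by (intro tendsto_divide nt) auto
  moreover have "\<forall>\<^sub>F t in at_right 0.
      S t (x t / a (n t) / l) / (real (n t) * t) = (1 - F (x t / l)) / t"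
    using small order_tendstoD(1)[OF nt zero_less_one]
  proof eventually_elim
    case (elim t)
    have "a (n t) * (x t / a (n t) / l) = x t / l" using a[of "n t"] by simp
    then show ?case using elim by (auto simp: S_def zero_less_mult_iff)
  qed
  moreover have "(1 / l) powr (- \<alpha>) / 1 = l powr \<alpha>"
    using \<open>l > 0\<close> by (simp add: powr_minus powr_divide)
  ultimately show ?thesis by (simp add: tendsto_cong)
qed


section \<open>Unrolling the max-autoregressive recursion\<close>

lemma max_recursion_le_iff:
  fixes c :: real and X Y :: "nat \<Rightarrow> real"
  assumes "c > 0" and rec: "\<And>n. n \<ge> 2 \<Longrightarrow> X n = max (c * X (n - 1)) (Y n)"
  shows "X (1 + r) \<le> x \<longleftrightarrow>
    c ^ r * X 1 \<le> x \<and> (\<forall>k\<in>{2..1 + r}. c ^ (1 + r - k) * Y k \<le> x)"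
proof (induction r arbitrary: x)
  case 0
  then show ?case by simp
next
  case (Suc r)
  have shift: "c ^ m * z \<le> x / c \<longleftrightarrow> c ^ Suc m * z \<le> x" for m z
    using \<open>c > 0\<close> by (simp add: field_simps)
  have "X (1 + Suc r) \<le> x \<longleftrightarrow> X (1 + r) \<le> x / c \<and> Y (1 + Suc r) \<le> x"
    using rec[of "1 + Suc r"] \<open>c > 0\<close> by (simp add: field_simps)
  also have "\<dots> \<longleftrightarrow> c ^ Suc r * X 1 \<le> x \<and>
      (\<forall>k\<in>{2..1 + r}. c ^ Suc (1 + r - k) * Y k \<le> x) \<and> Y (1 + Suc r) \<le> x"
    unfolding Suc.IH shift by blast
  also have "(\<forall>k\<in>{2..1 + r}. c ^ Suc (1 + r - k) * Y k \<le> x) \<longleftrightarrow>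
      (\<forall>k\<in>{2..1 + r}. c ^ (1 + Suc r - k) * Y k \<le> x)"
    by (intro ball_cong refl) (simp add: Suc_diff_le)
  also have "c ^ Suc r * X 1 \<le> x \<and> (\<forall>k\<in>{2..1 + r}. c ^ (1 + Suc r - k) * Y k \<le> x) \<and>
      Y (1 + Suc r) \<le> x \<longleftrightarrow>
      c ^ Suc r * X 1 \<le> x \<and> (\<forall>k\<in>insert (1 + Suc r) {2..1 + r}. c ^ (1 + Suc r - k) * Y k \<le> x)"
    by auto
  also have "insert (1 + Suc r) {2..1 + r} = {2..1 + Suc r}" by auto
  finally show ?case .
qed

lemma borel_measurable_vec_lambda:
  fixes f :: "'d::finite \<Rightarrow> 'a \<Rightarrow> real"
  assumes "\<And>i. f i \<in> borel_measurable N"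
  shows "(\<lambda>x. \<chi> i. f i x) \<in> borel_measurable N"
  using assms by (subst borel_measurable_euclidean_space) (auto simp: Basis_vec_def inner_axis)

lemma borel_measurable_vec_component [measurable]:
  "(\<lambda>z :: real ^ 'd. z $ i) \<in> borel_measurable borel"
  by (intro borel_measurable_continuous_onI continuous_intros)

locale max_autoregression = prob_space M for M :: "'a measure" +
  fixes X Y :: "nat \<Rightarrow> 'a \<Rightarrow> real ^ 'd" and c :: "'d \<Rightarrow> real"
  assumes c_pos: "\<And>i. 0 < c i"
    and indep: "indep_vars (\<lambda>_. borel) (\<lambda>n. if n = 0 then X 0 else Y n) UNIV"
    and rec: "\<And>n i \<omega>. n \<ge> 1 \<Longrightarrow> \<omega> \<in> space M \<Longrightarrow>
           X n \<omega> $ i = max (c i * X (n - 1) \<omega> $ i) (Y n \<omega> $ i)"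
begin

lemma rv_innovation: "n \<ge> 1 \<Longrightarrow> Y n \<in> borel_measurable M"
  and rv_start: "X 0 \<in> borel_measurable M"
  proof -
  have "(if n = 0 then X 0 else Y n) \<in> borel_measurable M" for n
    using indep unfolding indep_vars_def by blast
  from this[of n] this[of 0] show "n \<ge> 1 \<Longrightarrow> Y n \<in> borel_measurable M" "X 0 \<in> borel_measurable M"
    by auto
qed

lemma rv_X [measurable]: "X n \<in> borel_measurable M"
proof (induction n)
  case 0
  show ?case by (rule rv_start)
next
  case (Suc n)
  note [measurable] = Suc rv_innovation[of "Suc n"]
  have "(\<lambda>\<omega>. \<chi> i. max (c i * X n \<omega> $ i) (Y (Suc n) \<omega> $ i)) \<in> borel_measurable M"
    by (intro borel_measurable_vec_lambda) measurable
  then show ?case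
    by (rule measurable_cong[THEN iffD1, rotated]) (simp add: vec_eq_iff rec)
qed

text \<open>By the unrolled recursion, the lagged value lies below \<open>x\<close> iff \<open>c^r X\<^sub>1\<close> does and the innovations with
  indices \<open>2, \<dots>, 1 + r\<close> satisfy a condition of their own. The latter are independent of \<open>X\<^sub>1\<close>, which is a
  function of the variables with indices 0 and 1. What matters is that \<open>H\<close> does not depend on \<open>S\<close>: it can
  be computed from the sure event.\<close>

lemma lag_factorization:
  obtains H where "\<And>S. S \<in> sets borel \<Longrightarrow>
    \<P>(\<omega> in M. X 1 \<omega> \<in> S \<and> X (1 + r) \<omega> $ i \<le> x) =
    \<P>(\<omega> in M. X 1 \<omega> \<in> S \<and> c i ^ r * X 1 \<omega> $ i \<le> x) * H"
proof -
  let ?Z = "\<lambda>n. if n = 0 then X 0 else Y n"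
  define K where "K = {2..1 + r}"
  define step where "step f = (\<chi> k. max (c k * f 0 $ k) (f 1 $ k))" for f :: "nat \<Rightarrow> real ^ 'd"
  define E where "E = {f \<in> space (PiM K (\<lambda>_. borel)). \<forall>k\<in>K. c i ^ (1 + r - k) * f k $ i \<le> (x::real)}"
  have ind: "indep_var (PiM {0, 1} (\<lambda>_. borel)) (\<lambda>\<omega>. restrict (\<lambda>n. ?Z n \<omega>) {0, 1})
      (PiM K (\<lambda>_. borel)) (\<lambda>\<omega>. restrict (\<lambda>n. ?Z n \<omega>) K)"
    by (rule indep_var_restrict[OF indep]) (auto simp: K_def)
  have E: "E \<in> sets (PiM K (\<lambda>_. borel))"
    unfolding E_def by (measurable; simp add: K_def)
  have step: "step \<in> measurable (PiM {0, 1} (\<lambda>_. borel)) borel"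
    unfolding step_def by (intro borel_measurable_vec_lambda) measurable
  have X1: "X 1 \<omega> = step (restrict (\<lambda>n. ?Z n \<omega>) {0, 1})" if "\<omega> \<in> space M" for \<omega>
    using that by (simp add: step_def vec_eq_iff rec)
  define H where "H = prob ((\<lambda>\<omega>. restrict (\<lambda>n. ?Z n \<omega>) K) -` E \<inter> space M)"
  have "\<P>(\<omega> in M. X 1 \<omega> \<in> S \<and> X (1 + r) \<omega> $ i \<le> x) =
    \<P>(\<omega> in M. X 1 \<omega> \<in> S \<and> c i ^ r * X 1 \<omega> $ i \<le> x) * H" if S: "S \<in> sets borel" for S
  proof -
    define S' where "S' = S \<inter> {z. c i ^ r * z $ i \<le> x}"
    have "{z::real^'d. c i ^ r * z $ i \<le> x} \<in> sets borel"
      by (intro borel_closed closed_Collect_le continuous_intros)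
    then have S': "S' \<in> sets borel" using S by (auto simp: S'_def)
    define A where "A = step -` S' \<inter> space (PiM {0, 1} (\<lambda>_. borel))"
    have A: "A \<in> sets (PiM {0, 1} (\<lambda>_. borel))"
      unfolding A_def using step S' by (rule measurable_sets)
    \<comment> \<open>For \<open>r = 0\<close> the set \<open>K\<close> is empty, and the condition on the innovations is void.\<close>
    have iff: "X (1 + r) \<omega> $ i \<le> x \<longleftrightarrow>
        c i ^ r * X 1 \<omega> $ i \<le> x \<and> (\<forall>k\<in>K. c i ^ (1 + r - k) * Y k \<omega> $ i \<le> x)" if "\<omega> \<in> space M" for \<omega>
      unfolding K_def using that
      by (intro max_recursion_le_iff[where X = "\<lambda>n. X n \<omega> $ i" and Y = "\<lambda>n. Y n \<omega> $ i"])
         (simp_all add: c_pos rec)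
    have inE: "restrict (\<lambda>n. ?Z n \<omega>) K \<in> E \<longleftrightarrow> (\<forall>k\<in>K. c i ^ (1 + r - k) * Y k \<omega> $ i \<le> x)" for \<omega>
      by (auto simp: E_def space_PiM K_def)
    have inA: "restrict (\<lambda>n. ?Z n \<omega>) {0, 1} \<in> A \<longleftrightarrow> X 1 \<omega> \<in> S'" if "\<omega> \<in> space M" for \<omega>
      unfolding A_def X1[OF that] by (auto simp: space_PiM)
    have "prob ((\<lambda>\<omega>. (restrict (\<lambda>n. ?Z n \<omega>) {0, 1}, restrict (\<lambda>n. ?Z n \<omega>) K)) -` (A \<times> E) \<inter> space M)
        = prob ((\<lambda>\<omega>. restrict (\<lambda>n. ?Z n \<omega>) {0, 1}) -` A \<inter> space M) * H"
      unfolding H_def by (rule indep_varD[OF ind A E])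
    also have "(\<lambda>\<omega>. (restrict (\<lambda>n. ?Z n \<omega>) {0, 1}, restrict (\<lambda>n. ?Z n \<omega>) K)) -` (A \<times> E) \<inter> space M
        = {\<omega> \<in> space M. X 1 \<omega> \<in> S \<and> X (1 + r) \<omega> $ i \<le> x}"
      using iff inA inE unfolding S'_def by blast
    also have "(\<lambda>\<omega>. restrict (\<lambda>n. ?Z n \<omega>) {0, 1}) -` A \<inter> space M
        = {\<omega> \<in> space M. X 1 \<omega> \<in> S \<and> c i ^ r * X 1 \<omega> $ i \<le> x}"
      using inA unfolding S'_def by blast
    finally show ?thesis .
  qed
  then show ?thesis using that by blast
qed

end

section \<open>Random variables with continuous distribution function\<close>

locale continuous_margin = prob_space M for M :: "'a measure" +
  fixes Z :: "'a \<Rightarrow> real" and F :: "real \<Rightarrow> real"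
  assumes rv [measurable]: "Z \<in> borel_measurable M"
    and F: "F = cdf (distr M borel Z)"
    and cont: "continuous_on UNIV F"
begin

lemma cdf_eq_prob: "F y = \<P>(\<omega> in M. Z \<omega> \<le> y)"
  unfolding F cdf_def by (subst measure_distr) (auto intro!: arg_cong[where f = prob])

lemma mono_F: "mono F" and F_bounds: "0 \<le> F y" "F y \<le> 1"
  and F_top: "(F \<longlongrightarrow> 1) at_top" and F_bot: "(F \<longlongrightarrow> 0) at_bot"
proof -
  interpret Z: real_distribution "distr M borel Z" by simp
  show "mono F" "0 \<le> F y" "F y \<le> 1" "(F \<longlongrightarrow> 1) at_top" "(F \<longlongrightarrow> 0) at_bot"
    unfolding F using Z.cdf_lim_at_top_prob Z.cdf_lim_at_bot
    by (auto intro!: monoI Z.cdf_nondecreasing Z.cdf_nonneg Z.cdf_bounded_prob)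
qed

lemma F_measurable [measurable]: "F \<in> borel_measurable borel"
  using cont by (rule borel_measurable_continuous_onI)

lemma ex_quantile:
  assumes "0 < v" "v < 1"
  shows "\<exists>y. F y = v"
proof -
  obtain a b where "F a < v" "v < F b"
    using order_tendstoD(2)[OF F_bot assms(1)] order_tendstoD(1)[OF F_top assms(2)]
    unfolding eventually_at_bot_linorder eventually_at_top_linorder by blast
  moreover from this have "a \<le> b"
    using mono_F by (metis linear monoD not_less order.strict_trans)
  ultimately show ?thesis
    using IVT'[of F a v b] cont by (meson continuous_on_subset less_imp_le subset_UNIV)
qed

text \<open>\<open>F\<close> need not be strictly increasing. Below level 1 the level set \<open>L\<close> is a closed half-line whose right
  end point is again mapped to \<open>F y\<close>; at level 1 the event is sure, although \<open>L\<close> has no end point.\<close>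

lemma probability_integral_transform: "\<P>(\<omega> in M. F (Z \<omega>) \<le> F y) = F y"
proof (cases "F y = 1")
  case True
  then show ?thesis using F_bounds by (simp add: prob_space)
next
  case False
  then have "F y < 1" using F_bounds[of y] by simp
  define L where "L = {z. F z \<le> F y}"
  obtain b where b: "F y < F b"
    using order_tendstoD(1)[OF F_top \<open>F y < 1\<close>]
    unfolding eventually_at_top_linorder by blast
  have "closed L" unfolding L_def by (intro closed_Collect_le cont continuous_intros)
  moreover have "bdd_above L"
    using b mono_F unfolding L_def bdd_above_def
    by (metis linear mem_Collect_eq monoD not_less order.trans)
  moreover have "y \<in> L" by (simp add: L_def)
  ultimately have sup: "Sup L \<in> L" "\<And>z. z \<in> L \<Longrightarrow> z \<le> Sup L"
    using closed_contains_Sup[of L] cSup_upper[of _ L] by auto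
  have L: "F z \<le> F y \<longleftrightarrow> z \<le> Sup L" for z
    using sup mono_F unfolding L_def by (metis mem_Collect_eq monoD order.trans)
  have "F (Sup L) = F y"
    using sup(1) sup(2)[OF \<open>y \<in> L\<close>] mono_F unfolding L_def by (auto intro: antisym dest: monoD)
  then show ?thesis unfolding L cdf_eq_prob[symmetric] .
qed

text \<open>The event \<open>Z \<le> y\<close> is contained in \<open>F Z \<le> F y\<close> and has the same probability.\<close>

lemma prob_conj_transform:
  assumes [measurable]: "Measurable.pred M Q"
  shows "\<P>(\<omega> in M. Q \<omega> \<and> F (Z \<omega>) \<le> F y) = \<P>(\<omega> in M. Q \<omega> \<and> Z \<omega> \<le> y)"
proof -
  have "AE \<omega> in M. F (Z \<omega>) \<le> F y \<longleftrightarrow> Z \<omega> \<le> y"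
  proof (rule AE_I)
    have "prob ({\<omega>\<in>space M. F (Z \<omega>) \<le> F y} - {\<omega>\<in>space M. Z \<omega> \<le> y}) =
        prob {\<omega>\<in>space M. F (Z \<omega>) \<le> F y} - prob {\<omega>\<in>space M. Z \<omega> \<le> y}"
      using mono_F by (intro finite_measure_Diff) (auto dest: monoD)
    also have "\<dots> = 0"
      by (simp add: probability_integral_transform cdf_eq_prob[symmetric])
    finally show "emeasure M ({\<omega>\<in>space M. F (Z \<omega>) \<le> F y} - {\<omega>\<in>space M. Z \<omega> \<le> y}) = 0"
      by (simp add: emeasure_eq_measure)
    show "{\<omega> \<in> space M. \<not> (F (Z \<omega>) \<le> F y \<longleftrightarrow> Z \<omega> \<le> y)}
        \<subseteq> {\<omega>\<in>space M. F (Z \<omega>) \<le> F y} - {\<omega>\<in>space M. Z \<omega> \<le> y}"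
      using mono_F by (auto dest: monoD)
  qed measurable
  then show ?thesis by (intro prob_eq_AE) auto
qed

text \<open>Lipschitz continuity of a copula in one argument: moving the threshold changes the event only inside
  a strip, whose probability is the increment of \<open>F\<close>. Both levels are written as values of \<open>F\<close> so that the
  level 1, which \<open>F\<close> may or may not attain, needs no separate treatment.\<close>

lemma section_nonexpansive:
  assumes [measurable]: "Measurable.pred M Q"
  shows "\<bar>\<P>(\<omega> in M. Q \<omega> \<and> F (Z \<omega>) \<le> F y) - \<P>(\<omega> in M. Q \<omega> \<and> F (Z \<omega>) \<le> F z)\<bar> \<le> \<bar>F y - F z\<bar>"
proof -
  have *: "\<bar>\<P>(\<omega> in M. Q \<omega> \<and> Z \<omega> \<le> y) - \<P>(\<omega> in M. Q \<omega> \<and> Z \<omega> \<le> z)\<bar> \<le> \<bar>F y - F z\<bar>"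
    if "y \<le> z" for y z
  proof -
    have "\<P>(\<omega> in M. Q \<omega> \<and> Z \<omega> \<le> z) - \<P>(\<omega> in M. Q \<omega> \<and> Z \<omega> \<le> y) =
        prob ({\<omega>\<in>space M. Q \<omega> \<and> Z \<omega> \<le> z} - {\<omega>\<in>space M. Q \<omega> \<and> Z \<omega> \<le> y})"
      using that by (intro finite_measure_Diff[symmetric]) auto
    also have "\<dots> \<le> prob ({\<omega>\<in>space M. Z \<omega> \<le> z} - {\<omega>\<in>space M. Z \<omega> \<le> y})"
      by (intro finite_measure_mono) auto
    also have "\<dots> = F z - F y"
      unfolding cdf_eq_prob using that by (intro finite_measure_Diff) auto
    finally have "\<P>(\<omega> in M. Q \<omega> \<and> Z \<omega> \<le> z) - \<P>(\<omega> in M. Q \<omega> \<and> Z \<omega> \<le> y) \<le> F z - F y" .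
    moreover have "\<P>(\<omega> in M. Q \<omega> \<and> Z \<omega> \<le> y) \<le> \<P>(\<omega> in M. Q \<omega> \<and> Z \<omega> \<le> z)"
      using that by (intro finite_measure_mono) auto
    ultimately show ?thesis by linarith
  qed
  show ?thesis
    unfolding prob_conj_transform[OF assms] using *[of y z] *[of z y] by (cases "y \<le> z") auto
qed

end

section \<open>The tail dependence coefficient\<close>

lemma stationary_process_same_law:
  assumes "stationary_process M S Z" and [measurable]: "\<And>n. Z n \<in> measurable M S"
  shows "distr M S (Z k) = distr M S (Z 0)"
proof -
  have "distr M S (Z k) = distr (distr M (PiM UNIV (\<lambda>_. S)) (\<lambda>\<omega> n. Z (n + k) \<omega>)) S (\<lambda>f. f 0)" for k
    by (subst distr_distr)
       (auto simp: comp_def intro!: measurable_PiM_single' measurable_space[OF assms(2)])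
  then show ?thesis using assms(1) unfolding stationary_process_def by metis
qed

text \<open>Applied to the section \<open>v \<mapsto> C(u, v)\<close> of a copula: \<open>C(u, v) / v\<close> inherits the Lipschitz property as long as \<open>v\<close>
  stays away from 0.\<close>

lemma divided_section_diff_le:
  fixes v w Cv Cw :: real
  assumes "0 < v" "0 < w" "0 \<le> Cw" "Cw \<le> w" "\<bar>Cv - Cw\<bar> \<le> \<bar>v - w\<bar>"
  shows "\<bar>Cv / v - Cw / w\<bar> \<le> 2 * \<bar>v - w\<bar> / v"
proof -
  have "Cv / v - Cw / w = (Cv - Cw) / v + (Cw / w) * ((w - v) / v)"
    using assms by (simp add: field_simps)
  also have "\<bar>\<dots>\<bar> \<le> \<bar>Cv - Cw\<bar> / v + (Cw / w) * (\<bar>w - v\<bar> / v)"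
    using assms by (intro abs_triangle_ineq[THEN order.trans]) (simp add: abs_mult)
  also have "\<dots> \<le> \<bar>v - w\<bar> / v + 1 * (\<bar>w - v\<bar> / v)"
    using assms by (intro add_mono mult_right_mono divide_right_mono) auto
  finally show ?thesis by (simp add: abs_minus_commute)
qed
lemma (in prob_space) prob_neither:
  assumes [measurable]: "Measurable.pred M P" "Measurable.pred M Q"
  shows "\<P>(\<omega> in M. \<not> P \<omega> \<and> \<not> Q \<omega>) =
    1 - \<P>(\<omega> in M. P \<omega>) - \<P>(\<omega> in M. Q \<omega>) + \<P>(\<omega> in M. P \<omega> \<and> Q \<omega>)"
proof -
  have "\<P>(\<omega> in M. \<not> P \<omega> \<and> \<not> Q \<omega>) = prob ({\<omega>\<in>space M. \<not> P \<omega>} - ({\<omega>\<in>space M. Q \<omega>} - {\<omega>\<in>space M. P \<omega> \<and> Q \<omega>}))"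
    by (intro arg_cong[where f = prob]) auto
  also have "\<dots> = prob {\<omega>\<in>space M. \<not> P \<omega>} - prob ({\<omega>\<in>space M. Q \<omega>} - {\<omega>\<in>space M. P \<omega> \<and> Q \<omega>})"
    by (intro finite_measure_Diff) auto
  also have "prob ({\<omega>\<in>space M. Q \<omega>} - {\<omega>\<in>space M. P \<omega> \<and> Q \<omega>})
      = \<P>(\<omega> in M. Q \<omega>) - \<P>(\<omega> in M. P \<omega> \<and> Q \<omega>)"
    by (intro finite_measure_Diff) auto
  also have "prob {\<omega>\<in>space M. \<not> P \<omega>} = 1 - \<P>(\<omega> in M. P \<omega>)"
    by (intro prob_neg) measurable
  finally show ?thesis by simp
qed

theorem proposition5p2:
  fixes M :: "'a measure"
    and X Y :: "nat \<Rightarrow> 'a \<Rightarrow> real ^ 'd"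
    and c :: "'d \<Rightarrow> real"
    and F G :: "real ^ 'd \<Rightarrow> real"
    and Fm :: "'d \<Rightarrow> real \<Rightarrow> real"
    and j j' :: 'd
    and r m :: nat
    and \<alpha> :: real
  assumes "prob_space M"
    and "\<And>i. 0 < c i \<and> c i < 1"
    and "prob_space.indep_vars M (\<lambda>_. borel) (\<lambda>n. if n = 0 then X 0 else Y n) UNIV"
    and "\<And>n. n \<ge> 1 \<Longrightarrow> joint_cdf M (Y n) = G"
    and "\<And>n i \<omega>. n \<ge> 1 \<Longrightarrow> \<omega> \<in> space M \<Longrightarrow>
           X n \<omega> $ i = max (c i * X (n - 1) \<omega> $ i) (Y n \<omega> $ i)"
    and "stationary_process M borel (\<lambda>n. X (Suc n))"
    and "\<And>n. n \<ge> 1 \<Longrightarrow> joint_cdf M (X n) = F"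
    and "\<And>n i. n \<ge> 1 \<Longrightarrow> Fm i = cdf (distr M borel (\<lambda>\<omega>. X n \<omega> $ i))"
    and "\<And>i. continuous_on UNIV (Fm i)"
    and "\<alpha> > 0"
    and "in_max_domain (Fm j') (Frechet \<alpha>)"
    and "m \<ge> 1"
  defines "C \<equiv> copula M Fm (X m) j j'"
  defines "q \<equiv> (\<lambda>t. 1 / t * (1 - C (1 - t) (1 - t * c j' powr (real r * \<alpha>))
                     * ((1 - t) / (1 - t * c j' powr (real r * \<alpha>)))))"
  shows "(tail_dep_exists M Fm X r j j' \<longleftrightarrow> (\<exists>l. (q \<longlongrightarrow> l) (at_right 0))) \<and>
         (tail_dep_exists M Fm X r j j' \<longrightarrow>
            tail_dep M Fm X r j j' = 2 - Lim (at_right 0) q \<and>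
            0 \<le> tail_dep M Fm X r j j' \<and>
            tail_dep M Fm X r j j' \<le> c j' powr (\<alpha> * real r))"
proof -
  interpret prob_space M by fact
  interpret max_autoregression M X Y c
  proof unfold_locales
    show "0 < c i" for i using assms(2)[of i] by (rule conjunct1)
  qed (rule assms(3,5); assumption)+
  have margin: "continuous_margin M (\<lambda>\<omega>. X n \<omega> $ i) (Fm i)" if "n \<ge> 1" for n i
  proof unfold_locales
    show "(\<lambda>\<omega>. X n \<omega> $ i) \<in> borel_measurable M" by measurable
  qed (rule assms(8)[OF that] assms(9))+
  interpret J: continuous_margin M "\<lambda>\<omega>. X 1 \<omega> $ j" "Fm j" by (rule margin) simp
  interpret J': continuous_margin M "\<lambda>\<omega>. X 1 \<omega> $ j'" "Fm j'" by (rule margin) simp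
  interpret R: continuous_margin M "\<lambda>\<omega>. X (1 + r) \<omega> $ j'" "Fm j'" by (rule margin) simp

  have closed_lower: "{z :: real ^ 'd. Fm i (z $ i) \<le> u} \<in> sets borel" for i u
  proof -
    have "continuous_on UNIV (\<lambda>z :: real ^ 'd. z $ i)" by (intro continuous_intros)
    then have "continuous_on UNIV (\<lambda>z :: real ^ 'd. Fm i (z $ i))"
      using continuous_on_compose2[OF assms(9)[of i]] by blast
    then show ?thesis
      by (intro borel_closed closed_Collect_le continuous_on_const)
  qed
  have law: "distr M borel (X n) = distr M borel (X 1)" if "n \<ge> 1" for n
    using stationary_process_same_law[OF assms(6) rv_X, of "n - 1"] that by simp
  have C: "C u v = \<P>(\<omega> in M. Fm j (X 1 \<omega> $ j) \<le> u \<and> Fm j' (X 1 \<omega> $ j') \<le> v)" for u v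
  proof -
    let ?S = "{z. Fm j (z $ j) \<le> u} \<inter> {z. Fm j' (z $ j') \<le> v}"
    have *: "copula M Fm (X n) j j' u v = measure (distr M borel (X n)) ?S" for n
    proof -
      have "measure (distr M borel (X n)) ?S = prob (X n -` ?S \<inter> space M)"
        by (intro measure_distr rv_X sets.Int closed_lower)
      also have "X n -` ?S \<inter> space M =
          {\<omega>\<in>space M. Fm j (X n \<omega> $ j) \<le> u \<and> Fm j' (X n \<omega> $ j') \<le> v}" by auto
      finally show ?thesis unfolding copula_def by simp
    qed
    have "C u v = copula M Fm (X 1) j j' u v"
      unfolding C_def * law[OF \<open>m \<ge> 1\<close>] ..
    then show ?thesis unfolding copula_def .
  qed
  have C_section: "\<bar>C u (Fm j' y) - C u (Fm j' z)\<bar> \<le> \<bar>Fm j' y - Fm j' z\<bar>" for u y z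
    unfolding C by (rule J'.section_nonexpansive) measurable
  have C_nonneg: "0 \<le> C u v" for u v unfolding C by simp
  have C_le_right: "C u (Fm j' y) \<le> Fm j' y" for u y
    unfolding C by (subst (2) J'.probability_integral_transform[symmetric]) (intro finite_measure_mono; auto)
  have C_le_left: "C (Fm j y) v \<le> Fm j y" for y v
    unfolding C by (subst (2) J.probability_integral_transform[symmetric]) (intro finite_measure_mono; auto)

  define l where "l = c j' ^ r"
  define s where "s = c j' powr (real r * \<alpha>)"
  have c: "0 < c j'" "c j' < 1" using assms(2) by auto
  have "l > 0" using c by (simp add: l_def)
  have s_l: "s = l powr \<alpha>"
    using c by (simp add: s_def l_def powr_realpow[symmetric] powr_powr)
  have "0 < s" "s \<le> 1" using c \<open>\<alpha> > 0\<close> by (auto simp: s_def intro!: powr_le1)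

  \<comment> \<open>Any quantile will do; \<open>x\<close> is arbitrary outside \<open>0 < t < 1\<close>.\<close>
  define x where "x t = (SOME y. Fm j' y = 1 - t)" for t
  have x: "Fm j' (x t) = 1 - t" if "0 < t" "t < 1" for t
    unfolding x_def by (rule someI_ex[OF J'.ex_quantile]) (use that in auto)
  define v where "v t = Fm j' (x t / l)" for t
  define w where "w t = 1 - t * s" for t
  have vs: "((\<lambda>t. (1 - v t) / t) \<longlongrightarrow> s) (at_right 0)"
    unfolding v_def s_l
    by (rule Frechet_domain_tail_ratio[OF J'.mono_F J'.F_bounds(1) \<open>\<alpha> > 0\<close> assms(11) x \<open>l > 0\<close>])
  have small: "\<forall>\<^sub>F t::real in at_right 0. 0 < t \<and> t < 1"
    by (auto simp: eventually_at_right_field intro!: exI[of _ 1])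
  have v1: "(v \<longlongrightarrow> 1) (at_right 0)"
  proof -
    have "((\<lambda>t. 1 - t * ((1 - v t) / t)) \<longlongrightarrow> 1 - 0 * s) (at_right 0)"
      by (intro tendsto_intros vs)
    moreover have "\<forall>\<^sub>F t in at_right 0. 1 - t * ((1 - v t) / t) = v t"
      using small by eventually_elim simp
    ultimately show ?thesis by (simp add: tendsto_cong)
  qed
  have w: "0 < w t" "w t < 1" if "0 < t" "t < 1" for t
  proof -
    have "t * s \<le> t" using that \<open>s \<le> 1\<close> by (intro mult_left_le) auto
    moreover have "0 < t * s" using that \<open>0 < s\<close> by simp
    ultimately show "0 < w t" "w t < 1" using that unfolding w_def by linarith+
  qed

  have tail: "tail_prob M Fm X r j j' t = 2 - (1 - C (1 - t) (v t) * ((1 - t) / v t)) / t"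
    if t: "0 < t" "t < 1" and "v t > 0" for t
  proof -
    obtain y where y: "Fm j y = 1 - t" using J.ex_quantile[of "1 - t"] t by auto
    let ?A = "\<lambda>\<omega>. Fm j (X 1 \<omega> $ j) \<le> 1 - t" and ?B = "\<lambda>\<omega>. Fm j' (X (1 + r) \<omega> $ j') \<le> 1 - t"
    obtain H where H: "\<And>S. S \<in> sets borel \<Longrightarrow>
        \<P>(\<omega> in M. X 1 \<omega> \<in> S \<and> X (1 + r) \<omega> $ j' \<le> x t) =
        \<P>(\<omega> in M. X 1 \<omega> \<in> S \<and> l * X 1 \<omega> $ j' \<le> x t) * H"
      using lag_factorization[of r j' "x t"] unfolding l_def by blast
    have scale: "l * z \<le> x t \<longleftrightarrow> z \<le> x t / l" for z
      using \<open>l > 0\<close> by (simp add: field_simps)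
    \<comment> \<open>Stationarity of the margin, expressed through the sure event, determines \<open>H\<close>.\<close>
    have "1 - t = v t * H"
      using H[of UNIV] by (simp add: scale v_def J'.cdf_eq_prob[symmetric] R.cdf_eq_prob[symmetric] x[OF t] del: One_nat_def)
    then have "H = (1 - t) / v t" using \<open>v t > 0\<close> by (simp add: field_simps)
    have A: "prob {\<omega>\<in>space M. ?A \<omega>} = 1 - t"
      using J.probability_integral_transform[of y] by (simp add: y)
    have B: "prob {\<omega>\<in>space M. ?B \<omega>} = 1 - t"
      using R.probability_integral_transform[of "x t"] by (simp add: x t)
    have "\<P>(\<omega> in M. ?A \<omega> \<and> ?B \<omega>) = \<P>(\<omega> in M. ?A \<omega> \<and> X (1 + r) \<omega> $ j' \<le> x t)"
      unfolding x[OF t, symmetric] by (rule R.prob_conj_transform) measurable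
    also have "\<dots> = \<P>(\<omega> in M. ?A \<omega> \<and> X 1 \<omega> $ j' \<le> x t / l) * H"
      using H[OF closed_lower[of j "1 - t"]] by (simp add: scale)
    also have "\<P>(\<omega> in M. ?A \<omega> \<and> X 1 \<omega> $ j' \<le> x t / l) = C (1 - t) (v t)"
      unfolding C v_def by (rule J'.prob_conj_transform[symmetric]) measurable
    finally have AB: "\<P>(\<omega> in M. ?A \<omega> \<and> ?B \<omega>) = C (1 - t) (v t) * H" .
    have "\<P>(\<omega> in M. \<not> ?A \<omega>) = t"
      by (subst prob_neg) (simp_all add: A del: One_nat_def)
    moreover have "\<P>(\<omega> in M. \<not> ?A \<omega> \<and> \<not> ?B \<omega>) = 2 * t - 1 + C (1 - t) (v t) * H"
      by (subst prob_neither) (simp_all add: A B AB del: One_nat_def)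
    ultimately have "tail_prob M Fm X r j j' t = (2 * t - 1 + C (1 - t) (v t) * H) / t"
      unfolding tail_prob_def cond_prob_def by (simp add: not_le conj_commute del: One_nat_def)
    then show ?thesis
      using t by (simp add: \<open>H = _\<close> field_simps)
  qed

  have q: "q t = (1 - C (1 - t) (w t) * ((1 - t) / w t)) / t" for t
    by (simp add: q_def w_def s_def)
  \<comment> \<open>Replacing \<open>v t\<close> by \<open>w t\<close> costs \<open>\<bar>v t - w t\<bar> / t\<close>, up to a bounded factor.\<close>
  have diff: "((\<lambda>t. tail_prob M Fm X r j j' t - (2 - q t)) \<longlongrightarrow> 0) (at_right 0)"
  proof (rule Lim_null_comparison)
    show "\<forall>\<^sub>F t in at_right 0. norm (tail_prob M Fm X r j j' t - (2 - q t))
        \<le> 2 * \<bar>s - (1 - v t) / t\<bar> / v t"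
      using small order_tendstoD(1)[OF v1 zero_less_one]
    proof eventually_elim
      case (elim t)
      then have t: "0 < t" "t < 1" by auto
      obtain y where y: "Fm j' y = w t" using J'.ex_quantile w[OF t] by blast
      have "tail_prob M Fm X r j j' t - (2 - q t) =
          (1 - t) / t * (C (1 - t) (v t) / v t - C (1 - t) (w t) / w t)"
        using elim t w[OF t] by (simp add: tail q field_simps)
      also have "\<bar>\<dots>\<bar> = (1 - t) / t * \<bar>C (1 - t) (v t) / v t - C (1 - t) (w t) / w t\<bar>"
        using t by (simp add: abs_mult)
      also have "\<dots> \<le> 1 / t * (2 * \<bar>v t - w t\<bar> / v t)"
      proof (intro mult_mono divided_section_diff_le)
        show "C (1 - t) (w t) \<le> w t" using C_le_right[of _ y] by (simp add: y)
        show "\<bar>C (1 - t) (v t) - C (1 - t) (w t)\<bar> \<le> \<bar>v t - w t\<bar>"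
          using C_section[of _ "x t / l" y] by (simp add: y v_def)
      qed (use elim t w[OF t] C_nonneg in \<open>auto simp: divide_right_mono\<close>)
      also have "v t - w t = t * (s - (1 - v t) / t)"
        using t by (simp add: w_def field_simps)
      finally show ?case using t by (simp add: abs_mult)
    qed
    have "((\<lambda>t. 2 * \<bar>s - (1 - v t) / t\<bar> / v t) \<longlongrightarrow> 2 * \<bar>s - s\<bar> / 1) (at_right 0)"
      by (intro tendsto_intros vs v1) simp
    then show "((\<lambda>t. 2 * \<bar>s - (1 - v t) / t\<bar> / v t) \<longlongrightarrow> 0) (at_right 0)" by simp
  qed
  have tail_q: "(tail_prob M Fm X r j j' \<longlongrightarrow> k) (at_right 0) \<longleftrightarrow> (q \<longlongrightarrow> 2 - k) (at_right 0)" for k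
  proof
    assume "(tail_prob M Fm X r j j' \<longlongrightarrow> k) (at_right 0)"
    then have "((\<lambda>t. 2 - (tail_prob M Fm X r j j' t - (tail_prob M Fm X r j j' t - (2 - q t))))
        \<longlongrightarrow> 2 - (k - 0)) (at_right 0)"
      by (intro tendsto_diff tendsto_const diff)
    then show "(q \<longlongrightarrow> 2 - k) (at_right 0)" by simp
  next
    assume "(q \<longlongrightarrow> 2 - k) (at_right 0)"
    then have "((\<lambda>t. (tail_prob M Fm X r j j' t - (2 - q t)) + (2 - q t)) \<longlongrightarrow> 0 + (2 - (2 - k))) (at_right 0)"
      by (intro tendsto_add tendsto_diff tendsto_const diff)
    then show "(tail_prob M Fm X r j j' \<longlongrightarrow> k) (at_right 0)" by simp
  qed

  have exists_iff: "tail_dep_exists M Fm X r j j' \<longleftrightarrow> (\<exists>k. (q \<longlongrightarrow> k) (at_right 0))"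
  proof
    assume "tail_dep_exists M Fm X r j j'"
    then show "\<exists>k. (q \<longlongrightarrow> k) (at_right 0)" unfolding tail_dep_exists_def tail_q by blast
  next
    assume "\<exists>k. (q \<longlongrightarrow> k) (at_right 0)"
    then obtain k where "(q \<longlongrightarrow> 2 - (2 - k)) (at_right 0)" by auto
    then show "tail_dep_exists M Fm X r j j'" unfolding tail_dep_exists_def tail_q by blast
  qed
  have limit: "tail_dep M Fm X r j j' = 2 - Lim (at_right 0) q \<and>
      0 \<le> tail_dep M Fm X r j j' \<and> tail_dep M Fm X r j j' \<le> s"
    if ex: "tail_dep_exists M Fm X r j j'"
  proof -
    obtain k where k: "(tail_prob M Fm X r j j' \<longlongrightarrow> k) (at_right 0)"
      using ex unfolding tail_dep_exists_def by blast
    have qk: "(q \<longlongrightarrow> 2 - k) (at_right 0)" using k tail_q by blast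
    have td: "tail_dep M Fm X r j j' = k"
      unfolding tail_dep_def by (rule tendsto_Lim[OF trivial_limit_at_right_real k])
    have "Lim (at_right 0) q = 2 - k"
      by (rule tendsto_Lim[OF trivial_limit_at_right_real qk])
    moreover have "0 \<le> k"
      by (rule tendsto_lowerbound[OF k]) (auto simp: tail_prob_def cond_prob_def)
    moreover have "k \<le> s"
    proof (rule tendsto_le[OF trivial_limit_at_right_real])
      have "((\<lambda>t. 2 - q t) \<longlongrightarrow> 2 - (2 - k)) (at_right 0)"
        by (intro tendsto_intros qk)
      then show "((\<lambda>t. 2 - q t) \<longlongrightarrow> k) (at_right 0)" by simp
      \<comment> \<open>This is the value of \<open>2 - q t\<close> with the copula replaced by its bound \<open>1 - t\<close>.\<close>
      have "((\<lambda>t. 2 - (2 - s - t) / w t) \<longlongrightarrow> 2 - (2 - s - 0) / (1 - 0 * s)) (at_right 0)"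
        unfolding w_def by (intro tendsto_intros) simp
      then show "((\<lambda>t. 2 - (2 - s - t) / w t) \<longlongrightarrow> s) (at_right 0)" by simp
      show "\<forall>\<^sub>F t in at_right 0. 2 - q t \<le> 2 - (2 - s - t) / w t"
        using small
      proof eventually_elim
        case (elim t)
        then have t: "0 < t" "t < 1" by auto
        obtain y where y: "Fm j y = 1 - t" using J.ex_quantile[of "1 - t"] t by auto
        have "C (1 - t) (w t) \<le> 1 - t" using C_le_left[of y] by (simp add: y)
        then have "C (1 - t) (w t) * ((1 - t) / w t) \<le> (1 - t) * ((1 - t) / w t)"
          using t w[OF t] by (intro mult_right_mono) auto
        then have "(1 - (1 - t) * ((1 - t) / w t)) / t \<le> q t"
          unfolding q using t by (intro divide_right_mono) auto
        moreover have "(1 - (1 - t) * ((1 - t) / w t)) / t = (2 - s - t) / w t"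
        proof -
          have "(1 - (1 - t) * ((1 - t) / w t)) / t = (w t - (1 - t) * (1 - t)) / (t * w t)"
            using t w[OF t] by (simp add: field_simps)
          also have "w t - (1 - t) * (1 - t) = t * (2 - s - t)"
            by (simp add: w_def algebra_simps)
          finally show ?thesis using t by simp
        qed
        ultimately show ?case by simp
      qed
    qed
    ultimately show ?thesis by (simp add: td)
  qed
  show ?thesis
    using exists_iff limit unfolding s_def mult.commute[of \<alpha>] by blast
qed

end
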